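(* Let $C\subseteq\{Fa,Fu\}$. Then $\{\Gamma_i\Rightarrow\Delta_i\}_{i\in I}\vdash_{\mathbf{STL}(C,N,D)}\Gamma\Rightarrow\Delta$ iff $\{\Gamma_i\Rightarrow\Delta_i\}_{i\in I}\vDash_{\mathbf{T}(C)}\Gamma\Rightarrow\Delta$. The same holds with $\mathbf{STL}(C,N,D)$ replaced by $\mathbf{STL}(C,N,H)$ (over the language with $\supset$).
   Context: \textbf{Calculus.} Language $\{\wedge,\vee,\to,\top,\bot,\nabla\}$, plus $\supset$ for the $H$ version. Sequents are $\Gamma\Rightarrow\Delta$ with finite multisets and $|\Delta|\le1$; $\nabla\Gamma=\{\nabla\gamma\mid\gamma\in\Gamma\}$. $\mathbf{STL}$ rules (premises / conclusion): - Axioms: $A\Rightarrow A$; $\bot\Rightarrow$; $\Rightarrow\top$. - Weakening: $\Gamma\Rightarrow\Delta$ / $\Gamma,A\Rightarrow\Delta$; $\Gamma\Rightarrow$ / $\Gamma\Rightarrow A$. - Contraction: $\Gamma,A,A\Rightarrow\Delta$ / $\Gamma,A\Rightarrow\Delta$. - Cut: $\Gamma\Rightarrow A$, $\Pi,A\Rightarrow\Delta$ / $\Pi,\Gamma\Rightarrow\Delta$. - Conjunction: left rules for either conjunct; $\Gamma\Rightarrow A$, $\Gamma\Rightarrow B$ / $\Gamma\Rightarrow A\wedge B$. - Disjunction: $A\Rightarrow\Delta$, $B\Rightarrow\Delta$ / $A\vee B\Rightarrow\Delta$; right rules for either disjunct. - Modality: $A\Rightarrow B$ / $\nabla A\Rightarrow\nabla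 B$. - Left implication: $\Gamma\Rightarrow A$, $\Gamma,B\Rightarrow\Delta$ / $\Gamma,\nabla(A\to B)\Rightarrow\Delta$. - Right implication: $\nabla\Gamma,A\Rightarrow B$ / $\Gamma\Rightarrow A\to B$. Additional rules: - (N): $\Gamma\Rightarrow\Delta$ / $\nabla\Gamma\Rightarrow\nabla\Delta$. - (D): $\Gamma,A\Rightarrow\Delta$, $\Gamma,B\Rightarrow\Delta$ / $\Gamma,A\vee B\Rightarrow\Delta$. - (Fa): $\Gamma,A\Rightarrow B$ / $\Gamma\Rightarrow\nabla(A\to B)$. - (Fu): $\nabla\Gamma\Rightarrow A$, $\nabla\Gamma,B\Rightarrow\nabla\Delta$ / $\Gamma,A\to B\Rightarrow\Delta$. - (H): $\Gamma\Rightarrow A$, $\Gamma,B\Rightarrow\Delta$ / $\Gamma,A\supset B\Rightarrow\Delta$; $\Gamma,A\Rightarrow B$ / $\Gamma\Rightarrow A\supset B$. \textbf{Topological semantics.} A dynamic topological system is $(X,f)$ with $X$ a topological space and $f:X\to X$ continuous. It is faithful (Fa) if $f$ is a topological embedding and full (Fu) if $f$ is surjective. $\mathbf{T}(C)$ is the class of dynamic topological systems satisfying $C$. $f_*:\mathcal{O}(X)\to\mathcal{O}(X)$ is the right adjoint of $f^{-1}$ on open sets ($f^{-1}(W)\subseteq U$ iff $W\subseteq f_*(U)$). A topological model $(X,f,V)$ assigns open sets to formulas with: - $V(\top)=X$, $V(\bot)=\varnothing$; - $\wedge,\vee$ interpreted as $\cap,\cup$; - $V(\nabla A)=f^{-1}(V(A))$;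 - $V(A\supset B)=int(V(A)^c\cup V(B))$; - $V(A\to B)=f_*(int(V(A)^c\cup V(B)))$. It validates $\Gamma\Rightarrow\Delta$ if $\bigcap_{\gamma\in\Gamma}V(\gamma)\subseteq\bigcup_{\delta\in\Delta}V(\delta)$. $\mathcal{S}\vDash_{\mathbf{T}(C)}S$ means every topological model on a system in $\mathbf{T}(C)$ validating $\mathcal{S}$ validates $S$. *)

theory Defs
  imports "HOL-Analysis.Abstract_Topology" "HOL-Library.Multiset"
begin

datatype 'p fm =
    Atom 'p
  | Top (\<open>\<^bold>\<top>\<close>)
  | Bot (\<open>\<^bold>\<bottom>\<close>)
  | And "'p fm" "'p fm" (infixr \<open>\<^bold>\<and>\<close> 75)
  | Or "'p fm" "'p fm" (infixr \<open>\<^bold>\<or>\<close> 73)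
  | Imp "'p fm" "'p fm" (infixr \<open>\<^bold>\<rightarrow>\<close> 71)
  | Nabla "'p fm" (\<open>\<^bold>\<nabla> _\<close> [80] 80)
  | HImp "'p fm" "'p fm" (infixr \<open>\<^bold>\<supset>\<close> 71)

datatype 'p sequent =
  Seq (antecedent: "'p fm multiset") (succedent: "'p fm multiset") (infix \<open>\<Rrightarrow>\<close> 60)

datatype axiom_name = Fa | Fu | N | D | H

primrec supset_free :: "'p fm \<Rightarrow> bool" where
  "supset_free (Atom p) \<longleftrightarrow> True"
| "supset_free \<^bold>\<top> \<longleftrightarrow> True"
| "supset_free \<^bold>\<bottom> \<longleftrightarrow> True"
| "supset_free (A \<^bold>\<and> B) \<longleftrightarrow> supset_free A \<and> supset_free B"
| "supset_free (A \<^bold>\<or> B) \<longleftrightarrow> supset_free A \<and> supset_free B"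
| "supset_free (A \<^bold>\<rightarrow> B) \<longleftrightarrow> supset_free A \<and> supset_free B"
| "supset_free (\<^bold>\<nabla> A) \<longleftrightarrow> supset_free A"
| "supset_free (A \<^bold>\<supset> B) \<longleftrightarrow> False"

text \<open>The connective \<open>\<^bold>\<supset>\<close> belongs to the language exactly when the rules (H) are present.\<close>

definition language :: "axiom_name set \<Rightarrow> 'p fm set" where
  "language R = {A. H \<in> R \<or> supset_free A}"

definition sequents :: "axiom_name set \<Rightarrow> 'p sequent set" where
  "sequents R = {\<Gamma> \<Rrightarrow> \<Delta> |\<Gamma> \<Delta>.
     size \<Delta> \<le> 1 \<and> set_mset \<Gamma> \<subseteq> language R \<and> set_mset \<Delta> \<subseteq> language R}"

abbreviation Nablas :: "'p fm multiset \<Rightarrow> 'p fm multiset" where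
  "Nablas \<Gamma> \<equiv> image_mset Nabla \<Gamma>"

text \<open>\<open>stl_rule R Ps S\<close>: the sequent \<open>S\<close> is the conclusion of an instance, with premises \<open>Ps\<close>,
  of a rule of \<open>STL(R)\<close>. That all sequents lie in the language and have at most one formula in
  the succedent is imposed in \<open>derives\<close> below.\<close>

inductive stl_rule :: "axiom_name set \<Rightarrow> 'p sequent list \<Rightarrow> 'p sequent \<Rightarrow> bool"
  for R :: "axiom_name set" where
  identity: "stl_rule R [] ({#A#} \<Rrightarrow> {#A#})"
| bot_left: "stl_rule R [] ({#\<^bold>\<bottom>#} \<Rrightarrow> {#})"
| top_right: "stl_rule R [] ({#} \<Rrightarrow> {#\<^bold>\<top>#})"
| weak_left: "stl_rule R [\<Gamma> \<Rrightarrow> \<Delta>] (\<Gamma> + {#A#} \<Rrightarrow> \<Delta>)"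
| weak_right: "stl_rule R [\<Gamma> \<Rrightarrow> {#}] (\<Gamma> \<Rrightarrow> {#A#})"
| contr_left: "stl_rule R [\<Gamma> + {#A, A#} \<Rrightarrow> \<Delta>] (\<Gamma> + {#A#} \<Rrightarrow> \<Delta>)"
| cut: "stl_rule R [\<Gamma> \<Rrightarrow> {#A#}, \<Theta> + {#A#} \<Rrightarrow> \<Delta>] (\<Theta> + \<Gamma> \<Rrightarrow> \<Delta>)"
| and_left1: "stl_rule R [\<Gamma> + {#A#} \<Rrightarrow> \<Delta>] (\<Gamma> + {#A \<^bold>\<and> B#} \<Rrightarrow> \<Delta>)"
| and_left2: "stl_rule R [\<Gamma> + {#B#} \<Rrightarrow> \<Delta>] (\<Gamma> + {#A \<^bold>\<and> B#} \<Rrightarrow> \<Delta>)"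
| and_right: "stl_rule R [\<Gamma> \<Rrightarrow> {#A#}, \<Gamma> \<Rrightarrow> {#B#}] (\<Gamma> \<Rrightarrow> {#A \<^bold>\<and> B#})"
| or_left: "stl_rule R [{#A#} \<Rrightarrow> \<Delta>, {#B#} \<Rrightarrow> \<Delta>] ({#A \<^bold>\<or> B#} \<Rrightarrow> \<Delta>)"
| or_right1: "stl_rule R [\<Gamma> \<Rrightarrow> {#A#}] (\<Gamma> \<Rrightarrow> {#A \<^bold>\<or> B#})"
| or_right2: "stl_rule R [\<Gamma> \<Rrightarrow> {#B#}] (\<Gamma> \<Rrightarrow> {#A \<^bold>\<or> B#})"
| nabla: "stl_rule R [{#A#} \<Rrightarrow> {#B#}] ({#\<^bold>\<nabla> A#} \<Rrightarrow> {#\<^bold>\<nabla> B#})"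
| imp_left: "stl_rule R [\<Gamma> \<Rrightarrow> {#A#}, \<Gamma> + {#B#} \<Rrightarrow> \<Delta>] (\<Gamma> + {#\<^bold>\<nabla> (A \<^bold>\<rightarrow> B)#} \<Rrightarrow> \<Delta>)"
| imp_right: "stl_rule R [Nablas \<Gamma> + {#A#} \<Rrightarrow> {#B#}] (\<Gamma> \<Rrightarrow> {#A \<^bold>\<rightarrow> B#})"
| rule_N: "N \<in> R \<Longrightarrow> stl_rule R [\<Gamma> \<Rrightarrow> \<Delta>] (Nablas \<Gamma> \<Rrightarrow> Nablas \<Delta>)"
| rule_D: "D \<in> R \<Longrightarrow>
    stl_rule R [\<Gamma> + {#A#} \<Rrightarrow> \<Delta>, \<Gamma> + {#B#} \<Rrightarrow> \<Delta>] (\<Gamma> + {#A \<^bold>\<or> B#} \<Rrightarrow> \<Delta>)"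
| rule_Fa: "Fa \<in> R \<Longrightarrow>
    stl_rule R [\<Gamma> + {#A#} \<Rrightarrow> {#B#}] (\<Gamma> \<Rrightarrow> {#\<^bold>\<nabla> (A \<^bold>\<rightarrow> B)#})"
| rule_Fu: "Fu \<in> R \<Longrightarrow>
    stl_rule R [Nablas \<Gamma> \<Rrightarrow> {#A#}, Nablas \<Gamma> + {#B#} \<Rrightarrow> Nablas \<Delta>]
      (\<Gamma> + {#A \<^bold>\<rightarrow> B#} \<Rrightarrow> \<Delta>)"
| rule_H_left: "H \<in> R \<Longrightarrow>
    stl_rule R [\<Gamma> \<Rrightarrow> {#A#}, \<Gamma> + {#B#} \<Rrightarrow> \<Delta>] (\<Gamma> + {#A \<^bold>\<supset> B#} \<Rrightarrow> \<Delta>)"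
| rule_H_right: "H \<in> R \<Longrightarrow>
    stl_rule R [\<Gamma> + {#A#} \<Rrightarrow> {#B#}] (\<Gamma> \<Rrightarrow> {#A \<^bold>\<supset> B#})"

inductive derives :: "axiom_name set \<Rightarrow> 'p sequent set \<Rightarrow> 'p sequent \<Rightarrow> bool"
  for R :: "axiom_name set" and \<S> :: "'p sequent set" where
  hyp: "S \<in> \<S> \<Longrightarrow> S \<in> sequents R \<Longrightarrow> derives R \<S> S"
| step: "stl_rule R Ps S \<Longrightarrow> (\<forall>P \<in> set Ps. derives R \<S> P) \<Longrightarrow> S \<in> sequents R
    \<Longrightarrow> derives R \<S> S"

definition dyn_top_system :: "axiom_name set \<Rightarrow> 'x topology \<Rightarrow> ('x \<Rightarrow> 'x) \<Rightarrow> bool" where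
  "dyn_top_system C X f \<longleftrightarrow>
     continuous_map X X f \<and>
     (Fa \<in> C \<longrightarrow> embedding_map X X f) \<and>
     (Fu \<in> C \<longrightarrow> f ` topspace X = topspace X)"

definition preimage :: "'x topology \<Rightarrow> ('x \<Rightarrow> 'x) \<Rightarrow> 'x set \<Rightarrow> 'x set" where
  "preimage X f W = {x \<in> topspace X. f x \<in> W}"

definition direct_image :: "'x topology \<Rightarrow> ('x \<Rightarrow> 'x) \<Rightarrow> 'x set \<Rightarrow> 'x set" where
  "direct_image X f U = \<Union>{W. openin X W \<and> preimage X f W \<subseteq> U}"

text \<open>\<open>direct_image\<close> is the operation \<open>f\<^sub>*\<close>: it maps opens to opens and is right adjoint to
  the preimage on open sets, which determines it uniquely.\<close>

lemma openin_direct_image: "openin X (direct_image X f U)"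
  unfolding direct_image_def by auto

lemma direct_image_adjoint:
  assumes "openin X W"
  shows "preimage X f W \<subseteq> U \<longleftrightarrow> W \<subseteq> direct_image X f U"
  using assms unfolding direct_image_def preimage_def by blast

text \<open>For models of the language without \<open>\<^bold>\<supset>\<close>, the values on formulas containing \<open>\<^bold>\<supset>\<close> are
  determined by those on the atoms and impose no further constraint.\<close>

definition top_model :: "'x topology \<Rightarrow> ('x \<Rightarrow> 'x) \<Rightarrow> ('p fm \<Rightarrow> 'x set) \<Rightarrow> bool" where
  "top_model X f V \<longleftrightarrow>
     (\<forall>A. openin X (V A)) \<and>
     V \<^bold>\<top> = topspace X \<and>
     V \<^bold>\<bottom> = {} \<and>
     (\<forall>A B. V (A \<^bold>\<and> B) = V A \<inter> V B) \<and>
     (\<forall>A B. V (A \<^bold>\<or> B) = V A \<union> V B) \<and>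
     (\<forall>A. V (\<^bold>\<nabla> A) = preimage X f (V A)) \<and>
     (\<forall>A B. V (A \<^bold>\<supset> B) = X interior_of ((topspace X - V A) \<union> V B)) \<and>
     (\<forall>A B. V (A \<^bold>\<rightarrow> B) =
        direct_image X f (X interior_of ((topspace X - V A) \<union> V B)))"

definition validates :: "'x topology \<Rightarrow> ('p fm \<Rightarrow> 'x set) \<Rightarrow> 'p sequent \<Rightarrow> bool" where
  "validates X V S \<longleftrightarrow>
     topspace X \<inter> (\<Inter>\<gamma> \<in> set_mset (antecedent S). V \<gamma>)
       \<subseteq> (\<Union>\<delta> \<in> set_mset (succedent S). V \<delta>)"

text \<open>Consequence over the systems in \<open>T(C)\<close> whose points are taken from the type \<open>'x\<close>. The
  carrier \<open>topspace X\<close> may be any subset of the type. HOL formulas cannot quantify over types;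
  consequence over all systems is the conjunction of \<open>entails TYPE('x)\<close> over all \<open>'x\<close>. It is
  captured by soundness for an arbitrary \<open>'x\<close> together with completeness for one fixed type of
  points, sets of formulas.\<close>

definition entails ::
  "'x itself \<Rightarrow> axiom_name set \<Rightarrow> 'p sequent set \<Rightarrow> 'p sequent \<Rightarrow> bool" where
  "entails _ C \<S> S \<longleftrightarrow>
     (\<forall>(X :: 'x topology) f V. dyn_top_system C X f \<longrightarrow> top_model X f V \<longrightarrow>
        (\<forall>S' \<in> \<S>. validates X V S') \<longrightarrow> validates X V S)"

end

theory Submission
  imports Defs
begin

text \<open>Soundness is a check of each rule; the rules for \<open>\<^bold>\<rightarrow>\<close> come from the two adjunctions
  \<open>f\<^sup>-\<^sup>1 \<stileturn> f\<^sub>*\<close> and \<open>U \<inter> _ \<stileturn> int (U\<^sup>c \<union> _)\<close>.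

  For completeness, take the prime theories over \<open>\<S>\<close> with the topology of all sets upward closed
  under inclusion, and let \<open>f P = {A. \<nabla>A \<in> P}\<close>. Rule (N) and the adjunction between \<open>\<nabla>\<close> and
  \<open>\<top> \<rightarrow> _\<close>, which makes \<open>\<nabla>\<close> preserve disjunctions, show that \<open>f P\<close> is again prime. Under (Fa)
  \<open>A\<close> is equivalent to \<open>\<nabla>(\<top> \<rightarrow> A)\<close>, so \<open>f\<close> reflects inclusion and is an embedding. Under (Fu)
  \<open>\<nabla>\<close> reflects entailment, so for a prime \<open>P\<close> the theory generated by \<open>\<nabla>P\<close> avoids every \<open>\<nabla>E\<close>
  with \<open>E \<notin> P\<close>; a prime extension avoiding all of them is a preimage of \<open>P\<close>.\<close>

section \<open>Soundness\<close>

lemma openin_preimage: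
  assumes "continuous_map X X f" "openin X W"
  shows "openin X (preimage X f W)"
  using assms unfolding preimage_def by (rule openin_continuous_map_preimage)

text \<open>Openness onto the image makes the image of \<open>U\<close> the trace of some open
  \<open>W\<close> on the range, and injectivity keeps the preimage of \<open>W\<close> inside
  \<open>U\<close>. This is the semantic content of (Fa).\<close>

lemma embedding_open_is_preimage:
  assumes emb: "embedding_map X X f" and U: "openin X U"
  obtains W where "openin X W" "preimage X f W = U"
proof -
  have hom: "homeomorphic_map X (subtopology X (f ` topspace X)) f"
    using emb by (simp add: embedding_map_def)
  then have "openin (subtopology X (f ` topspace X)) (f ` U)"
    using U homeomorphic_map_openness_eq by blast
  then obtain W where W: "openin X W" "f ` U = W \<inter> f ` topspace X"
    by (auto simp: openin_subtopology)
  have inj: "inj_on f (topspace X)"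
    using hom by (simp add: homeomorphic_eq_everything_map)
  have "preimage X f W = U"
  proof
    show "preimage X f W \<subseteq> U"
    proof
      fix x assume "x \<in> preimage X f W"
      then have x: "x \<in> topspace X" "f x \<in> f ` U"
        using W by (auto simp: preimage_def)
      then show "x \<in> U"
        using inj openin_subset[OF U] by (meson inj_on_image_mem_iff)
    qed
    show "U \<subseteq> preimage X f W"
      using W openin_subset[OF U] by (auto simp: preimage_def)
  qed
  with W that show thesis by blast
qed

lemma validates_iff:
  "validates X V (\<Gamma> \<Rrightarrow> \<Delta>) \<longleftrightarrow>
     (\<forall>x \<in> topspace X. (\<forall>\<gamma> \<in># \<Gamma>. x \<in> V \<gamma>) \<longrightarrow> (\<exists>\<delta> \<in># \<Delta>. x \<in> V \<delta>))"
  unfolding validates_def by auto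

lemma stl_rule_sound:
  assumes rule: "stl_rule R Ps S"
    and sys: "dyn_top_system C X f" and model: "top_model X f V"
    and sub: "Fa \<in> R \<Longrightarrow> Fa \<in> C" "Fu \<in> R \<Longrightarrow> Fu \<in> C"
    and prems: "\<forall>P \<in> set Ps. validates X V P"
  shows "validates X V S"
proof -
  have op: "openin X (V A)" for A
    using model by (simp add: top_model_def)
  have sub_top: "V A \<subseteq> topspace X" for A
    using op openin_subset by blast
  have V_simps [simp]: "V \<^bold>\<top> = topspace X" "V \<^bold>\<bottom> = {}" "V (A \<^bold>\<and> B) = V A \<inter> V B"
    "V (A \<^bold>\<or> B) = V A \<union> V B" "V (\<^bold>\<nabla> A) = preimage X f (V A)" for A B
    using model by (simp_all add: top_model_def)
  have V_himp: "V (A \<^bold>\<supset> B) = X interior_of ((topspace X - V A) \<union> V B)" for A B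
    using model by (simp add: top_model_def)
  \<comment> \<open>A model evaluates \<open>HImp\<close> whether or not (H) is in \<open>R\<close>,
    so this value can serve as an auxiliary open set in every case.\<close>
  have V_imp: "V (A \<^bold>\<rightarrow> B) = direct_image X f (V (A \<^bold>\<supset> B))" for A B
    using model by (simp add: top_model_def)
  have himpE: "x \<in> V B" if "x \<in> V (A \<^bold>\<supset> B)" "x \<in> V A" for x A B
    using that interior_of_subset[of X "(topspace X - V A) \<union> V B"] unfolding V_himp by blast
  have himpI: "W \<subseteq> V (A \<^bold>\<supset> B)" if "openin X W" "W \<inter> V A \<subseteq> V B" for W A B
    unfolding V_himp using that openin_subset[of X W] by (intro interior_of_maximal) auto
  have impE: "y \<in> V (A \<^bold>\<supset> B)" if "y \<in> topspace X" "f y \<in> V (A \<^bold>\<rightarrow> B)" for y A B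
    using direct_image_adjoint[OF op, of f "A \<^bold>\<rightarrow> B" "V (A \<^bold>\<supset> B)"] that
    unfolding V_imp preimage_def by auto
  have cont: "continuous_map X X f"
    using sys by (simp add: dyn_top_system_def)
  \<comment> \<open>The set denoted by an antecedent, with the whole space for the empty one. It has
    to be open before either adjunction can be applied to it.\<close>
  let ?G = "\<lambda>\<Gamma>. {x \<in> topspace X. \<forall>\<gamma> \<in># \<Gamma>. x \<in> V \<gamma>}"
  have openG: "openin X (?G \<Gamma>)" for \<Gamma>
  proof (induction \<Gamma>)
    case (add A \<Gamma>)
    have "?G (add_mset A \<Gamma>) = V A \<inter> ?G \<Gamma>"
      using sub_top by auto
    then show ?case
      using add op by auto
  qed simp
  show ?thesis
    using rule
  proof cases
    case (nabla A B)
    then show ?thesis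
      using prems sub_top by (fastforce simp: validates_iff preimage_def)
  next
    case (imp_left \<Gamma> A B \<Delta>)
    then show ?thesis
      using prems impE himpE by (fastforce simp: validates_iff preimage_def)
  next
    case (imp_right \<Gamma> A B)
    \<comment> \<open>The preimage lies in the value of every formula of
      \<open>Nablas \<Gamma>\<close>, so the premise applies. The result is then transposed across
      \<open>HImp\<close> and across \<open>direct_image\<close>.\<close>
    have "preimage X f (?G \<Gamma>) \<inter> V A \<subseteq> V B"
      using prems imp_right by (auto simp: validates_iff preimage_def)
    then have "preimage X f (?G \<Gamma>) \<subseteq> V (A \<^bold>\<supset> B)"
      by (intro himpI openin_preimage[OF cont] openG)
    then have "?G \<Gamma> \<subseteq> V (A \<^bold>\<rightarrow> B)"
      unfolding V_imp using direct_image_adjoint[OF openG] by blast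
    then show ?thesis
      using imp_right by (auto simp: validates_iff)
  next
    case (rule_N \<Gamma> \<Delta>)
    have "f x \<in> topspace X" if "x \<in> topspace X" for x
      using cont that by (auto simp: continuous_map_def)
    then show ?thesis
      using prems rule_N by (auto simp: validates_iff preimage_def)
  next
    case (rule_Fa \<Gamma> A B)
    have "embedding_map X X f"
      using sys sub rule_Fa by (simp add: dyn_top_system_def)
    \<comment> \<open>Since \<open>W\<close> lies in the direct image of its own preimage, an open
      set of the form \<open>preimage X f W\<close> lies in the preimage of its direct
      image.\<close>
    then obtain W where W: "openin X W" "preimage X f W = V (A \<^bold>\<supset> B)"
      using embedding_open_is_preimage op by blast
    then have "W \<subseteq> V (A \<^bold>\<rightarrow> B)"
      unfolding V_imp using direct_image_adjoint[of X W f "V (A \<^bold>\<supset> B)"] by simp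
    then have "V (A \<^bold>\<supset> B) \<subseteq> V (\<^bold>\<nabla> (A \<^bold>\<rightarrow> B))"
      unfolding W(2)[symmetric] by (auto simp: preimage_def)
    moreover have "?G \<Gamma> \<subseteq> V (A \<^bold>\<supset> B)"
      using prems rule_Fa openG by (intro himpI) (auto simp: validates_iff)
    ultimately show ?thesis
      unfolding rule_Fa validates_iff by auto
  next
    case (rule_Fu \<Gamma> A B \<Delta>)
    have surj: "f ` topspace X = topspace X"
      using sys sub rule_Fu by (simp add: dyn_top_system_def)
    show ?thesis
      unfolding rule_Fu validates_iff
    proof (intro ballI impI)
      fix x assume x: "x \<in> topspace X" "\<forall>\<gamma> \<in># \<Gamma> + {#A \<^bold>\<rightarrow> B#}. x \<in> V \<gamma>"
      \<comment> \<open>The premises of (Fu) speak of formulas under \<open>Nabla\<close>, so they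
        are evaluated at a point that \<open>f\<close> sends to \<open>x\<close>.\<close>
      then obtain y where y: "y \<in> topspace X" "x = f y"
        using surj by blast
      then have "y \<in> V A"
        using prems rule_Fu x by (auto simp: validates_iff preimage_def)
      moreover have "y \<in> V (A \<^bold>\<supset> B)"
        using impE x y by auto
      ultimately have "y \<in> V B"
        using himpE by blast
      then show "\<exists>\<delta> \<in># \<Delta>. x \<in> V \<delta>"
        using prems rule_Fu x y by (auto simp: validates_iff preimage_def)
    qed
  next
    case (rule_H_left \<Gamma> A B \<Delta>)
    then show ?thesis
      using prems himpE by (fastforce simp: validates_iff)
  next
    case (rule_H_right \<Gamma> A B)
    have "?G \<Gamma> \<subseteq> V (A \<^bold>\<supset> B)"
      using prems rule_H_right openG by (intro himpI) (auto simp: validates_iff)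
    then show ?thesis
      using rule_H_right by (auto simp: validates_iff)
  qed (use prems in \<open>auto simp: validates_iff\<close>)
qed

text \<open>Validity is propagated inside one fixed model, which matches the reading of
  \<open>\<S>\<close> as global hypotheses.\<close>

theorem soundness:
  assumes "derives R \<S> S" and "Fa \<in> R \<Longrightarrow> Fa \<in> C" "Fu \<in> R \<Longrightarrow> Fu \<in> C"
  shows "entails TYPE('x) C \<S> S"
  unfolding entails_def
proof (intro allI impI)
  fix X :: "'x topology" and f V
  assume sys: "dyn_top_system C X f" "top_model X f V" and hyps: "\<forall>S' \<in> \<S>. validates X V S'"
  from assms(1) show "validates X V S"
  proof induction
    case (hyp S)
    then show ?case using hyps by blast
  next
    case (step Ps S)
    then show ?case
      using stl_rule_sound[OF step.hyps(1) sys assms(2,3)] by blast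
  qed
qed

section \<open>Derived rules\<close>

lemma sequents_iff [simp]:
  "(\<Gamma> \<Rrightarrow> \<Delta>) \<in> sequents R \<longleftrightarrow>
     size \<Delta> \<le> 1 \<and> set_mset \<Gamma> \<subseteq> language R \<and> set_mset \<Delta> \<subseteq> language R"
  by (simp add: sequents_def)

lemma language_simps [simp]:
  "Atom p \<in> language R"
  "\<^bold>\<top> \<in> language R"
  "\<^bold>\<bottom> \<in> language R"
  "A \<^bold>\<and> B \<in> language R \<longleftrightarrow> A \<in> language R \<and> B \<in> language R"
  "A \<^bold>\<or> B \<in> language R \<longleftrightarrow> A \<in> language R \<and> B \<in> language R"
  "A \<^bold>\<rightarrow> B \<in> language R \<longleftrightarrow> A \<in> language R \<and> B \<in> language R"
  "\<^bold>\<nabla> A \<in> language R \<longleftrightarrow> A \<in> language R"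
  by (auto simp: language_def)

lemma language_HImp:
  "A \<^bold>\<supset> B \<in> language R \<longleftrightarrow> H \<in> R \<and> A \<in> language R \<and> B \<in> language R"
  by (auto simp: language_def)

lemma derives_in_sequents: "derives R \<S> S \<Longrightarrow> S \<in> sequents R"
  by (induction rule: derives.induct) auto

text \<open>Both calculi of the theorem are instances. (N) keeps \<open>shift\<close> within the
  prime theories; (D) or (H) splits disjunctions inside a context.\<close>

locale modal_calculus =
  fixes R :: "axiom_name set" and \<S> :: "'p sequent set"
  assumes N_in: "N \<in> R" and D_or_H: "D \<in> R \<or> H \<in> R"
begin

abbreviation entails_syn :: "'p fm multiset \<Rightarrow> 'p fm multiset \<Rightarrow> bool" (infix \<open>\<turnstile>\<close> 55) where
  "\<Gamma> \<turnstile> \<Delta> \<equiv> derives R \<S> (\<Gamma> \<Rrightarrow> \<Delta>)"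

abbreviation L :: "'p fm set" where
  "L \<equiv> language R"

lemma wf:
  assumes "\<Gamma> \<turnstile> \<Delta>"
  shows "size \<Delta> \<le> 1" "set_mset \<Gamma> \<subseteq> L" "set_mset \<Delta> \<subseteq> L"
  using derives_in_sequents[OF assms] by auto

lemma infer0: "stl_rule R [] (\<Gamma> \<Rrightarrow> \<Delta>) \<Longrightarrow> (\<Gamma> \<Rrightarrow> \<Delta>) \<in> sequents R \<Longrightarrow> \<Gamma> \<turnstile> \<Delta>"
  by (rule derives.step) auto

lemma infer1:
  "stl_rule R [P] (\<Gamma> \<Rrightarrow> \<Delta>) \<Longrightarrow> derives R \<S> P \<Longrightarrow> (\<Gamma> \<Rrightarrow> \<Delta>) \<in> sequents R \<Longrightarrow> \<Gamma> \<turnstile> \<Delta>"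
  by (rule derives.step) auto

lemma infer2:
  "stl_rule R [P, Q] (\<Gamma> \<Rrightarrow> \<Delta>) \<Longrightarrow> derives R \<S> P \<Longrightarrow> derives R \<S> Q \<Longrightarrow>
     (\<Gamma> \<Rrightarrow> \<Delta>) \<in> sequents R \<Longrightarrow> \<Gamma> \<turnstile> \<Delta>"
  by (rule derives.step) auto

lemma identity: "A \<in> L \<Longrightarrow> {#A#} \<turnstile> {#A#}"
  by (rule infer0[OF stl_rule.identity]) auto

lemma bot_left: "{#\<^bold>\<bottom>#} \<turnstile> {#}"
  by (rule infer0[OF stl_rule.bot_left]) auto

lemma top_right: "{#} \<turnstile> {#\<^bold>\<top>#}"
  by (rule infer0[OF stl_rule.top_right]) auto

lemma weaken:
  assumes "\<Gamma> \<turnstile> \<Delta>" "set_mset \<Theta> \<subseteq> L"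
  shows "\<Gamma> + \<Theta> \<turnstile> \<Delta>"
  using assms(2)
proof (induction \<Theta>)
  case (add A \<Theta>)
  then have "\<Gamma> + \<Theta> \<turnstile> \<Delta>" by simp
  from infer1[OF stl_rule.weak_left this, of A] wf[OF this] add.prems show ?case by simp
qed (use assms in simp)

lemma contract:
  assumes "\<Gamma> + \<Theta> \<turnstile> \<Delta>" "set_mset \<Theta> \<subseteq> set_mset \<Gamma>"
  shows "\<Gamma> \<turnstile> \<Delta>"
  using assms
proof (induction \<Theta>)
  case (add A \<Theta>)
  then obtain \<Gamma>' where \<Gamma>': "\<Gamma> = add_mset A \<Gamma>'"
    by (auto dest: multi_member_split)
  have prem: "(\<Gamma>' + \<Theta>) + {#A, A#} \<turnstile> \<Delta>"
    using add.prems \<Gamma>' by simp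
  from infer1[OF stl_rule.contr_left prem] wf[OF prem] have "\<Gamma> + \<Theta> \<turnstile> \<Delta>"
    using \<Gamma>' by simp
  then show ?case
    using add by simp
qed simp

text \<open>Weakening by all of \<open>\<Theta>\<close> and then contracting \<open>\<Gamma>\<close>
  away shows that an antecedent counts only through its set of formulas. This is what allows
  theories to be sets.\<close>

lemma structural:
  assumes "\<Gamma> \<turnstile> \<Delta>" "set_mset \<Gamma> \<subseteq> set_mset \<Theta>" "set_mset \<Theta> \<subseteq> L"
  shows "\<Theta> \<turnstile> \<Delta>"
  using contract[of \<Theta> \<Gamma> \<Delta>] weaken[OF assms(1,3)] assms(2) by (simp add: add.commute)

lemma weak_right:
  assumes "\<Gamma> \<turnstile> {#}" "A \<in> L"
  shows "\<Gamma> \<turnstile> {#A#}"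
  by (rule infer1[OF stl_rule.weak_right assms(1)])
    (use assms wf[OF assms(1)] in \<open>auto simp: language_HImp image_subset_iff subset_iff\<close>)

lemma cut:
  assumes "\<Gamma> \<turnstile> {#A#}" "\<Theta> + {#A#} \<turnstile> \<Delta>"
  shows "\<Theta> + \<Gamma> \<turnstile> \<Delta>"
  by (rule infer2[OF stl_rule.cut assms(1,2)])
    (use assms wf[OF assms(1)] wf[OF assms(2)] in \<open>auto simp: language_HImp image_subset_iff subset_iff\<close>)

lemma cut1: "\<Gamma> \<turnstile> {#A#} \<Longrightarrow> {#A#} \<turnstile> \<Delta> \<Longrightarrow> \<Gamma> \<turnstile> \<Delta>"
  using cut[of \<Gamma> A "{#}"] by simp

lemma or_left:
  assumes "{#A#} \<turnstile> \<Delta>" "{#B#} \<turnstile> \<Delta>"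
  shows "{#A \<^bold>\<or> B#} \<turnstile> \<Delta>"
  by (rule infer2[OF stl_rule.or_left assms(1,2)])
    (use assms wf[OF assms(1)] wf[OF assms(2)] in \<open>auto simp: language_HImp image_subset_iff subset_iff\<close>)

lemma or_right1:
  assumes "\<Gamma> \<turnstile> {#A#}" "B \<in> L"
  shows "\<Gamma> \<turnstile> {#A \<^bold>\<or> B#}"
  by (rule infer1[OF stl_rule.or_right1 assms(1)])
    (use assms wf[OF assms(1)] in \<open>auto simp: language_HImp image_subset_iff subset_iff\<close>)

lemma or_right2:
  assumes "\<Gamma> \<turnstile> {#B#}" "A \<in> L"
  shows "\<Gamma> \<turnstile> {#A \<^bold>\<or> B#}"
  by (rule infer1[OF stl_rule.or_right2 assms(1)])
    (use assms wf[OF assms(1)] in \<open>auto simp: language_HImp image_subset_iff subset_iff\<close>)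

lemma nabla:
  assumes "{#A#} \<turnstile> {#B#}"
  shows "{#\<^bold>\<nabla> A#} \<turnstile> {#\<^bold>\<nabla> B#}"
  by (rule infer1[OF stl_rule.nabla assms(1)])
    (use assms wf[OF assms(1)] in \<open>auto simp: language_HImp image_subset_iff subset_iff\<close>)

lemma imp_right:
  assumes "set_mset \<Gamma> \<subseteq> L" "Nablas \<Gamma> + {#A#} \<turnstile> {#B#}"
  shows "\<Gamma> \<turnstile> {#A \<^bold>\<rightarrow> B#}"
  by (rule infer1[OF stl_rule.imp_right assms(2)])
    (use assms wf[OF assms(2)] in \<open>auto simp: language_HImp image_subset_iff subset_iff\<close>)

lemma imp_left:
  assumes "\<Gamma> \<turnstile> {#A#}" "\<Gamma> + {#B#} \<turnstile> \<Delta>"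
  shows "\<Gamma> + {#\<^bold>\<nabla> (A \<^bold>\<rightarrow> B)#} \<turnstile> \<Delta>"
  by (rule infer2[OF stl_rule.imp_left assms(1,2)])
    (use assms wf[OF assms(1)] wf[OF assms(2)] in \<open>auto simp: language_HImp image_subset_iff subset_iff\<close>)

lemma rule_N:
  assumes "\<Gamma> \<turnstile> \<Delta>"
  shows "Nablas \<Gamma> \<turnstile> Nablas \<Delta>"
  by (rule infer1[OF stl_rule.rule_N[OF N_in] assms(1)])
    (use assms wf[OF assms(1)] in \<open>auto simp: language_HImp image_subset_iff subset_iff\<close>)

lemma rule_Fa:
  assumes "Fa \<in> R" "\<Gamma> + {#A#} \<turnstile> {#B#}"
  shows "\<Gamma> \<turnstile> {#\<^bold>\<nabla> (A \<^bold>\<rightarrow> B)#}"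
  by (rule infer1[OF stl_rule.rule_Fa[OF assms(1)] assms(2)])
    (use assms wf[OF assms(2)] in \<open>auto simp: language_HImp image_subset_iff subset_iff\<close>)

lemma rule_Fu:
  assumes "Fu \<in> R" "Nablas \<Gamma> \<turnstile> {#A#}" "Nablas \<Gamma> + {#B#} \<turnstile> Nablas \<Delta>"
  shows "\<Gamma> + {#A \<^bold>\<rightarrow> B#} \<turnstile> \<Delta>"
  by (rule infer2[OF stl_rule.rule_Fu[OF assms(1)] assms(2,3)])
    (use wf[OF assms(2)] wf[OF assms(3)] in \<open>auto simp: image_subset_iff\<close>)

lemma rule_H_left:
  assumes "H \<in> R" "\<Gamma> \<turnstile> {#A#}" "\<Gamma> + {#B#} \<turnstile> \<Delta>"
  shows "\<Gamma> + {#A \<^bold>\<supset> B#} \<turnstile> \<Delta>"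
  by (rule infer2[OF stl_rule.rule_H_left[OF assms(1)] assms(2,3)])
    (use assms wf[OF assms(2)] wf[OF assms(3)] in \<open>auto simp: language_HImp image_subset_iff subset_iff\<close>)

lemma rule_H_right:
  assumes "H \<in> R" "\<Gamma> + {#A#} \<turnstile> {#B#}"
  shows "\<Gamma> \<turnstile> {#A \<^bold>\<supset> B#}"
  by (rule infer1[OF stl_rule.rule_H_right[OF assms(1)] assms(2)])
    (use assms wf[OF assms(2)] in \<open>auto simp: language_HImp image_subset_iff subset_iff\<close>)

section \<open>Modus ponens, disjunction in a context, and the adjunction of
  \<open>Nabla\<close>\<close>

text \<open>The counit of the adjunction between "\<open>A\<close> and \<open>Nabla\<close> of a
  formula" and implication from \<open>A\<close>.\<close>

lemma nabla_imp_mp: "A \<in> L \<Longrightarrow> B \<in> L \<Longrightarrow> {#A, \<^bold>\<nabla> (A \<^bold>\<rightarrow> B)#} \<turnstile> {#B#}"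
  using imp_left[of "{#A#}" A B "{#B#}"] identity weaken[OF identity, of B "{#A#}"]
  by (simp add: add_mset_commute)

lemma himp_mp: "H \<in> R \<Longrightarrow> A \<in> L \<Longrightarrow> B \<in> L \<Longrightarrow> {#A, A \<^bold>\<supset> B#} \<turnstile> {#B#}"
  using rule_H_left[of "{#A#}" A B "{#B#}"] identity weaken[OF identity, of B "{#A#}"]
  by (simp add: add_mset_commute)

text \<open>With (H), the context is moved to the right of \<open>\<^bold>\<supset>\<close> until \<open>or_left\<close> applies.\<close>

lemma or_left_context_H:
  assumes "H \<in> R" "\<Gamma> + {#A#} \<turnstile> {#E#}" "\<Gamma> + {#B#} \<turnstile> {#E#}"
  shows "\<Gamma> + {#A \<^bold>\<or> B#} \<turnstile> {#E#}"
  using assms(2,3)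
proof (induction \<Gamma> arbitrary: E)
  case empty
  then show ?case using or_left by simp
next
  case (add G \<Gamma>)
  have "\<Gamma> + {#A#} \<turnstile> {#G \<^bold>\<supset> E#}" "\<Gamma> + {#B#} \<turnstile> {#G \<^bold>\<supset> E#}"
    using add.prems by (auto intro!: rule_H_right[OF assms(1)] simp: add_mset_commute)
  then have "\<Gamma> + {#A \<^bold>\<or> B#} \<turnstile> {#G \<^bold>\<supset> E#}"
    by (rule add.IH)
  moreover have "{#G#} + {#G \<^bold>\<supset> E#} \<turnstile> {#E#}"
    using himp_mp[OF assms(1), of G E] wf[OF add.prems(1)] by (simp add: add_mset_commute)
  ultimately show ?case
    using cut by fastforce
qed

text \<open>The distributivity on which the existence of prime theories rests: (D) states it
  outright, while (H) supplies it by residuation.\<close>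

lemma or_left_context:
  assumes "\<Gamma> + {#A#} \<turnstile> {#E#}" "\<Gamma> + {#B#} \<turnstile> {#E#}"
  shows "\<Gamma> + {#A \<^bold>\<or> B#} \<turnstile> {#E#}"
proof (cases "H \<in> R")
  case True
  then show ?thesis using or_left_context_H assms by blast
next
  case False
  then have "D \<in> R" using D_or_H by blast
  from infer2[OF stl_rule.rule_D[OF this] assms] wf[OF assms(1)] wf[OF assms(2)]
  show ?thesis by simp
qed

text \<open>A left adjoint preserves joins: each disjunct is transposed to
  \<open>Imp Top ?Z\<close>, the two are joined by \<open>or_left\<close>, and the result is
  transposed back.\<close>

lemma nabla_or:
  assumes "A \<in> L" "B \<in> L"
  shows "{#\<^bold>\<nabla> (A \<^bold>\<or> B)#} \<turnstile> {#\<^bold>\<nabla> A \<^bold>\<or> \<^bold>\<nabla> B#}"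
proof -
  let ?Z = "\<^bold>\<nabla> A \<^bold>\<or> \<^bold>\<nabla> B"
  have "{#\<^bold>\<nabla> A#} + {#\<^bold>\<top>#} \<turnstile> {#?Z#}" "{#\<^bold>\<nabla> B#} + {#\<^bold>\<top>#} \<turnstile> {#?Z#}"
    by (rule weaken; use assms in \<open>simp add: or_right1 or_right2 identity\<close>)+
  then have "{#A#} \<turnstile> {#\<^bold>\<top> \<^bold>\<rightarrow> ?Z#}" "{#B#} \<turnstile> {#\<^bold>\<top> \<^bold>\<rightarrow> ?Z#}"
    using assms by (auto intro!: imp_right)
  then have "{#\<^bold>\<nabla> (A \<^bold>\<or> B)#} \<turnstile> {#\<^bold>\<nabla> (\<^bold>\<top> \<^bold>\<rightarrow> ?Z)#}"
    by (intro nabla or_left)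
  moreover have "{#\<^bold>\<nabla> (\<^bold>\<top> \<^bold>\<rightarrow> ?Z)#} \<turnstile> {#?Z#}"
    using imp_left[OF top_right, of ?Z] identity[of ?Z] assms by simp
  ultimately show ?thesis by (rule cut1)
qed

text \<open>Taking \<top> for both \<open>A\<close> and \<open>B\<close> in (Fu) strips
  \<open>Nabla\<close> from both sides. The extra formula \<open>Imp Top Top\<close> is provable and
  is cut away.\<close>

lemma nabla_reflects:
  assumes "Fu \<in> R" "Nablas \<Gamma> \<turnstile> Nablas \<Delta>"
  shows "\<Gamma> \<turnstile> \<Delta>"
proof -
  have "set_mset \<Gamma> \<subseteq> L"
    using wf[OF assms(2)] by auto
  then have "Nablas \<Gamma> \<turnstile> {#\<^bold>\<top>#}"
    using weaken[OF top_right, of "Nablas \<Gamma>"] by (simp add: image_subset_iff subset_eq)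
  moreover have "Nablas \<Gamma> + {#\<^bold>\<top>#} \<turnstile> Nablas \<Delta>"
    using weaken[OF assms(2), of "{#\<^bold>\<top>#}"] by simp
  ultimately have "\<Gamma> + {#\<^bold>\<top> \<^bold>\<rightarrow> \<^bold>\<top>#} \<turnstile> \<Delta>"
    by (rule rule_Fu[OF assms(1)])
  moreover have "{#} \<turnstile> {#\<^bold>\<top> \<^bold>\<rightarrow> \<^bold>\<top>#}"
    using imp_right[of "{#}"] identity by simp
  ultimately show ?thesis
    using cut by fastforce
qed

section \<open>Prime theories\<close>

text \<open>Each derivation uses finitely many members of \<open>T\<close>, which is the compactness
  behind the chain step of Zorn's lemma. With the succedent \<open>{#}\<close> it expresses
  inconsistency.\<close>

definition proves :: "'p fm set \<Rightarrow> 'p fm multiset \<Rightarrow> bool" where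
  "proves T \<Delta> \<longleftrightarrow> (\<exists>\<Gamma>. set_mset \<Gamma> \<subseteq> T \<and> \<Gamma> \<turnstile> \<Delta>)"

text \<open>These are the prime filters of the Lindenbaum algebra; the hypotheses
  \<open>\<S>\<close> enter through derivability.\<close>

definition prime :: "'p fm set \<Rightarrow> bool" where
  "prime P \<longleftrightarrow> P \<subseteq> L \<and> (\<forall>A. proves P {#A#} \<longrightarrow> A \<in> P) \<and> \<not> proves P {#} \<and>
     (\<forall>A B. A \<^bold>\<or> B \<in> P \<longrightarrow> A \<in> P \<or> B \<in> P)"

lemma proves_insert:
  assumes "proves (insert A T) \<Delta>" "A \<in> L"
  obtains \<Gamma> where "set_mset \<Gamma> \<subseteq> T" "\<Gamma> + {#A#} \<turnstile> \<Delta>"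
proof -
  obtain \<Theta> where \<Theta>: "set_mset \<Theta> \<subseteq> insert A T" "\<Theta> \<turnstile> \<Delta>"
    using assms by (auto simp: proves_def)
  let ?\<Gamma> = "filter_mset (\<lambda>B. B \<noteq> A) \<Theta>"
  have "?\<Gamma> + {#A#} \<turnstile> \<Delta>"
    by (rule structural[OF \<Theta>(2)]) (use wf[OF \<Theta>(2)] assms in auto)
  with \<Theta> that[of ?\<Gamma>] show thesis by auto
qed

lemma primeD:
  assumes "prime P"
  shows prime_subset: "P \<subseteq> L"
    and prime_closed: "\<Gamma> \<turnstile> {#A#} \<Longrightarrow> set_mset \<Gamma> \<subseteq> P \<Longrightarrow> A \<in> P"
    and prime_consistent: "\<Gamma> \<turnstile> {#} \<Longrightarrow> \<not> set_mset \<Gamma> \<subseteq> P"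
    and prime_or: "A \<^bold>\<or> B \<in> P \<Longrightarrow> A \<in> P \<or> B \<in> P"
  using assms unfolding prime_def proves_def by blast+

section \<open>Separation by prime theories\<close>

text \<open>The prime filter theorem for distributive lattices: a maximal theory proving no member
  of \<open>I\<close> is prime. Avoiding a whole family at once, rather than one formula, is what
  the surjectivity of \<open>shift\<close> requires.\<close>

lemma prime_extension:
  assumes T: "T \<subseteq> L" and I: "I \<subseteq> L" "I \<noteq> {}"
    and directed: "\<And>A B. A \<in> I \<Longrightarrow> B \<in> I \<Longrightarrow> A \<^bold>\<or> B \<in> I"
    and avoid: "\<And>A. A \<in> I \<Longrightarrow> \<not> proves T {#A#}"
  obtains P where "prime P" "T \<subseteq> P" "P \<inter> I = {}"
proof -
  let ?\<A> = "{P. T \<subseteq> P \<and> P \<subseteq> L \<and> (\<forall>A \<in> I. \<not> proves P {#A#})}"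
  have "\<exists>U \<in> ?\<A>. \<forall>Z \<in> K. Z \<subseteq> U" if K: "subset.chain ?\<A> K" for K
  proof (cases "K = {}")
    case True
    then show ?thesis using T avoid by blast
  next
    case False
    have K_sub: "T \<subseteq> Z" "Z \<subseteq> L" "\<And>A. A \<in> I \<Longrightarrow> \<not> proves Z {#A#}" if "Z \<in> K" for Z
      using subset.chain_def[of ?\<A> K] K that by auto
    have "\<not> proves (\<Union>K) {#A#}" if A: "A \<in> I" for A
    proof
      assume "proves (\<Union>K) {#A#}"
      then obtain \<Gamma> where \<Gamma>: "set_mset \<Gamma> \<subseteq> \<Union>K" "\<Gamma> \<turnstile> {#A#}"
        by (auto simp: proves_def)
      \<comment> \<open>The finite support of the derivation already lies in one member of the
        chain.\<close>
      obtain Z where "Z \<in> K" "set_mset \<Gamma> \<subseteq> Z"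
        using finite_subset_Union_chain[OF finite_set_mset \<Gamma>(1) False K] by blast
      then show False
        using K_sub(3)[OF _ A] \<Gamma>(2) unfolding proves_def by blast
    qed
    moreover have "T \<subseteq> \<Union>K"
      using K_sub(1) False by fast
    moreover have "\<Union>K \<subseteq> L"
      using K_sub(2) by (rule Union_least)
    ultimately have "\<Union>K \<in> ?\<A>" by simp
    then show ?thesis by (rule bexI[rotated]) (simp add: Union_upper)
  qed
  then have "\<exists>M \<in> ?\<A>. \<forall>Q \<in> ?\<A>. M \<subseteq> Q \<longrightarrow> Q = M"
    by (rule subset_Zorn)
  then obtain P where P: "T \<subseteq> P" "P \<subseteq> L" "\<forall>A \<in> I. \<not> proves P {#A#}"
    and max: "\<forall>Q \<in> ?\<A>. P \<subseteq> Q \<longrightarrow> Q = P"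
    by blast
  \<comment> \<open>Maximality: any new formula makes some member of \<open>I\<close>
    provable.\<close>
  have extend: "\<exists>\<Gamma> E. E \<in> I \<and> set_mset \<Gamma> \<subseteq> P \<and> \<Gamma> + {#A#} \<turnstile> {#E#}"
    if A: "A \<in> L" "A \<notin> P" for A
  proof -
    have "insert A P \<notin> ?\<A>"
      using max A by blast
    then obtain E where "E \<in> I" "proves (insert A P) {#E#}"
      using P A by blast
    then show ?thesis
      using A proves_insert by metis
  qed
  have "P \<inter> I = {}"
  proof -
    have "proves P {#A#}" if "A \<in> P" for A
      unfolding proves_def by (rule exI[of _ "{#A#}"]) (use that P identity in auto)
    then show ?thesis using P by blast
  qed
  moreover have "prime P"
    unfolding prime_def
  proof (intro conjI allI impI)
    show "P \<subseteq> L" by fact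
  next
    fix A assume "proves P {#A#}"
    then obtain \<Gamma> where \<Gamma>: "set_mset \<Gamma> \<subseteq> P" "\<Gamma> \<turnstile> {#A#}"
      by (auto simp: proves_def)
    show "A \<in> P"
    proof (rule ccontr)
      assume "A \<notin> P"
      moreover have "A \<in> L"
        using wf[OF \<Gamma>(2)] by simp
      ultimately obtain \<Theta> E where E: "E \<in> I" "set_mset \<Theta> \<subseteq> P" "\<Theta> + {#A#} \<turnstile> {#E#}"
        using extend by meson
      have "\<Theta> + \<Gamma> \<turnstile> {#E#}"
        using cut \<Gamma> E by blast
      moreover have "set_mset (\<Theta> + \<Gamma>) \<subseteq> P"
        using \<Gamma> E by simp
      ultimately show False
        using P E unfolding proves_def by blast
    qed
  next
    \<comment> \<open>Weakening on the right would turn a contradiction into a proof of a member of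
      \<open>I\<close>, which exists because \<open>I\<close> is nonempty.\<close>
    show "\<not> proves P {#}"
      using P I weak_right unfolding proves_def by blast
  next
    fix A B assume AB: "A \<^bold>\<or> B \<in> P"
    then have AB_L: "A \<in> L" "B \<in> L" using P by auto
    show "A \<in> P \<or> B \<in> P"
    proof (rule ccontr)
      assume "\<not> (A \<in> P \<or> B \<in> P)"
      then obtain \<Gamma> E \<Theta> F where E: "E \<in> I" "set_mset \<Gamma> \<subseteq> P" "\<Gamma> + {#A#} \<turnstile> {#E#}"
        and F: "F \<in> I" "set_mset \<Theta> \<subseteq> P" "\<Theta> + {#B#} \<turnstile> {#F#}"
        using extend AB_L by meson
      have EF: "E \<in> L" "F \<in> L" using E F I by auto
      \<comment> \<open>Merging the contexts and weakening both succedents to a common disjunction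
        prepares \<open>or_left_context\<close>. Directedness puts that disjunction in
        \<open>I\<close>, against the choice of \<open>P\<close>.\<close>
      have "(\<Gamma> + \<Theta>) + {#A#} \<turnstile> {#E \<^bold>\<or> F#}"
        by (rule structural[OF or_right1[OF E(3) EF(2)]]) (use E F P AB_L in auto)
      moreover have "(\<Gamma> + \<Theta>) + {#B#} \<turnstile> {#E \<^bold>\<or> F#}"
        by (rule structural[OF or_right2[OF F(3) EF(1)]]) (use E F P AB_L in auto)
      ultimately have "(\<Gamma> + \<Theta>) + {#A \<^bold>\<or> B#} \<turnstile> {#E \<^bold>\<or> F#}"
        by (rule or_left_context)
      moreover have "set_mset ((\<Gamma> + \<Theta>) + {#A \<^bold>\<or> B#}) \<subseteq> P"
        using E F AB by simp
      ultimately show False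
        using P directed[OF E(1) F(1)] unfolding proves_def by blast
    qed
  qed
  ultimately show thesis using that P by blast
qed

text \<open>The family to avoid is the principal ideal below \<open>B\<close>, since the singleton
  of \<open>B\<close> is not closed under \<open>Or\<close>.\<close>

lemma prime_extension_avoiding:
  assumes T: "T \<subseteq> L" and B: "B \<in> L" and avoid: "\<not> proves T {#B#}"
  obtains P where "prime P" "T \<subseteq> P" "B \<notin> P"
proof -
  let ?I = "{E. {#E#} \<turnstile> {#B#}}"
  have "B \<in> ?I" using identity B by simp
  moreover have "?I \<subseteq> L" using wf by fastforce
  moreover have "\<not> proves T {#E#}" if "E \<in> ?I" for E
    using that avoid cut1 unfolding proves_def by blast
  ultimately obtain P where "prime P" "T \<subseteq> P" "P \<inter> ?I = {}"
    using prime_extension[OF T, of ?I] or_left by blast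
  then show thesis using that \<open>B \<in> ?I\<close> by blast
qed

lemma prime_mem:
  assumes P: "prime P"
  shows prime_top: "\<^bold>\<top> \<in> P"
    and prime_bot: "\<^bold>\<bottom> \<notin> P"
    and prime_and_iff: "A \<^bold>\<and> B \<in> P \<longleftrightarrow> A \<in> P \<and> B \<in> P"
    and prime_or_iff: "A \<in> L \<Longrightarrow> B \<in> L \<Longrightarrow> A \<^bold>\<or> B \<in> P \<longleftrightarrow> A \<in> P \<or> B \<in> P"
proof -
  show "\<^bold>\<top> \<in> P" using prime_closed[OF P top_right] by simp
  show "\<^bold>\<bottom> \<notin> P" using prime_consistent[OF P bot_left] by simp
  show "A \<^bold>\<and> B \<in> P \<longleftrightarrow> A \<in> P \<and> B \<in> P"
  proof (intro iffI conjI)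
    assume AB: "A \<^bold>\<and> B \<in> P"
    then have L: "A \<in> L" "B \<in> L" using prime_subset[OF P] by auto
    have "{#A \<^bold>\<and> B#} \<turnstile> {#A#}"
      using infer1[OF stl_rule.and_left1[of R "{#}" A "{#A#}" B]] identity L by simp
    then show "A \<in> P" using prime_closed[OF P] AB by simp
    have "{#A \<^bold>\<and> B#} \<turnstile> {#B#}"
      using infer1[OF stl_rule.and_left2[of R "{#}" B "{#B#}" A]] identity L by simp
    then show "B \<in> P" using prime_closed[OF P] AB by simp
  next
    assume AB: "A \<in> P \<and> B \<in> P"
    then have L: "A \<in> L" "B \<in> L" using prime_subset[OF P] by auto
    have "{#A, B#} \<turnstile> {#A#}" "{#A, B#} \<turnstile> {#B#}"
      using structural[OF identity, of A "{#A, B#}"] structural[OF identity, of B "{#A, B#}"] L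
      by auto
    then have "{#A, B#} \<turnstile> {#A \<^bold>\<and> B#}"
      using infer2[OF stl_rule.and_right] L by simp
    then show "A \<^bold>\<and> B \<in> P" using prime_closed[OF P] AB by simp
  qed
  show "A \<^bold>\<or> B \<in> P \<longleftrightarrow> A \<in> P \<or> B \<in> P" if L: "A \<in> L" "B \<in> L"
  proof
    assume "A \<in> P \<or> B \<in> P"
    then show "A \<^bold>\<or> B \<in> P"
      using prime_closed[OF P or_right1[OF identity]] prime_closed[OF P or_right2[OF identity]] L
      by auto
  qed (rule prime_or[OF P])
qed

section \<open>The canonical system\<close>

text \<open>The dynamics of the canonical system, chosen so that the preimage of "contains
  \<open>A\<close>" is "contains \<open>Nabla A\<close>".\<close>

definition shift :: "'p fm set \<Rightarrow> 'p fm set" where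
  "shift P = {A. \<^bold>\<nabla> A \<in> P}"

text \<open>(N) applies to whole antecedents and also to the empty succedent, so it transfers
  closure and consistency; \<open>nabla_or\<close> transfers primeness.\<close>

lemma prime_shift:
  assumes P: "prime P"
  shows "prime (shift P)"
  unfolding prime_def
proof (intro conjI allI impI)
  show "shift P \<subseteq> L"
    using prime_subset[OF P] by (auto simp: shift_def)
next
  fix A assume "proves (shift P) {#A#}"
  then obtain \<Gamma> where \<Gamma>: "set_mset \<Gamma> \<subseteq> shift P" "\<Gamma> \<turnstile> {#A#}"
    by (auto simp: proves_def)
  then show "A \<in> shift P"
    using prime_closed[OF P, of "Nablas \<Gamma>" "\<^bold>\<nabla> A"] rule_N[OF \<Gamma>(2)] by (auto simp: shift_def)
next
  show "\<not> proves (shift P) {#}"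
  proof
    assume "proves (shift P) {#}"
    then obtain \<Gamma> where \<Gamma>: "set_mset \<Gamma> \<subseteq> shift P" "\<Gamma> \<turnstile> {#}"
      by (auto simp: proves_def)
    then show False
      using prime_consistent[OF P, of "Nablas \<Gamma>"] rule_N[OF \<Gamma>(2)] by (auto simp: shift_def)
  qed
next
  fix A B assume AB: "A \<^bold>\<or> B \<in> shift P"
  then have L: "A \<in> L" "B \<in> L" using prime_subset[OF P] by (auto simp: shift_def)
  have "\<^bold>\<nabla> A \<^bold>\<or> \<^bold>\<nabla> B \<in> P"
    using prime_closed[OF P nabla_or[OF L]] AB by (simp add: shift_def)
  then show "A \<in> shift P \<or> B \<in> shift P"
    using prime_or[OF P] by (simp add: shift_def)
qed

section \<open>Implications in prime theories\<close>

text \<open>A Kripke clause for the relation \<open>P \<subseteq> shift Q\<close>. If no such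
  \<open>Q\<close> refutes the implication, then \<open>A\<close> together with the
  \<open>Nabla\<close>-image of \<open>P\<close> proves \<open>B\<close>, and right implication
  transposes this.\<close>

lemma prime_imp_iff:
  assumes P: "prime P" and L: "A \<in> L" "B \<in> L"
  shows "A \<^bold>\<rightarrow> B \<in> P \<longleftrightarrow> (\<forall>Q. prime Q \<longrightarrow> P \<subseteq> shift Q \<longrightarrow> A \<in> Q \<longrightarrow> B \<in> Q)"
proof (intro iffI allI impI)
  fix Q assume "A \<^bold>\<rightarrow> B \<in> P" and Q: "prime Q" "P \<subseteq> shift Q" "A \<in> Q"
  then have "\<^bold>\<nabla> (A \<^bold>\<rightarrow> B) \<in> Q" by (auto simp: shift_def)
  then show "B \<in> Q"
    using prime_closed[OF Q(1) nabla_imp_mp[OF L]] Q by simp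
next
  assume all: "\<forall>Q. prime Q \<longrightarrow> P \<subseteq> shift Q \<longrightarrow> A \<in> Q \<longrightarrow> B \<in> Q"
  let ?T = "insert A (Nabla ` P)"
  have "?T \<subseteq> L"
    using prime_subset[OF P] L by auto
  then have "\<exists>Q. prime Q \<and> ?T \<subseteq> Q \<and> B \<notin> Q" if "\<not> proves ?T {#B#}"
    using prime_extension_avoiding[OF _ L(2) that] by metis
  moreover have "P \<subseteq> shift Q" if "?T \<subseteq> Q" for Q
    using that by (auto simp: shift_def)
  ultimately have "proves ?T {#B#}"
    using all by (meson insert_subset)
  then obtain \<Gamma> where \<Gamma>: "set_mset \<Gamma> \<subseteq> Nabla ` P" "\<Gamma> + {#A#} \<turnstile> {#B#}"
    using proves_insert L by blast
  \<comment> \<open>Right implication needs an antecedent of the literal form \<open>Nablas\<close>,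
    so the context is rebuilt from a finite part of \<open>P\<close>; multiplicities are repaired by
    \<open>structural\<close>.\<close>
  then obtain F where F: "F \<subseteq> P" "finite F" "set_mset \<Gamma> = Nabla ` F"
    by (meson finite_set_mset finite_subset_image)
  have "Nablas (mset_set F) + {#A#} \<turnstile> {#B#}"
    by (rule structural[OF \<Gamma>(2)]) (use F L prime_subset[OF P] in auto)
  then have "mset_set F \<turnstile> {#A \<^bold>\<rightarrow> B#}"
    by (intro imp_right) (use F prime_subset[OF P] in auto)
  then show "A \<^bold>\<rightarrow> B \<in> P"
    using prime_closed[OF P] F by auto
qed

lemma prime_himp_iff:
  assumes P: "prime P" and "H \<in> R" and L: "A \<in> L" "B \<in> L"
  shows "A \<^bold>\<supset> B \<in> P \<longleftrightarrow> (\<forall>Q. prime Q \<longrightarrow> P \<subseteq> Q \<longrightarrow> A \<in> Q \<longrightarrow> B \<in> Q)"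
proof (intro iffI allI impI)
  fix Q assume "A \<^bold>\<supset> B \<in> P" and Q: "prime Q" "P \<subseteq> Q" "A \<in> Q"
  then show "B \<in> Q"
    using prime_closed[OF Q(1) himp_mp[OF assms(2) L]] by auto
next
  assume all: "\<forall>Q. prime Q \<longrightarrow> P \<subseteq> Q \<longrightarrow> A \<in> Q \<longrightarrow> B \<in> Q"
  have "insert A P \<subseteq> L"
    using prime_subset[OF P] L by auto
  then have "\<exists>Q. prime Q \<and> insert A P \<subseteq> Q \<and> B \<notin> Q" if "\<not> proves (insert A P) {#B#}"
    using prime_extension_avoiding[OF _ L(2) that] by metis
  then have "proves (insert A P) {#B#}"
    using all by blast
  then obtain \<Gamma> where \<Gamma>: "set_mset \<Gamma> \<subseteq> P" "\<Gamma> + {#A#} \<turnstile> {#B#}"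
    using proves_insert L by blast
  then show "A \<^bold>\<supset> B \<in> P"
    using prime_closed[OF P] rule_H_right[OF assms(2)] by blast
qed

section \<open>The dynamics under (Fa) and (Fu)\<close>

text \<open>Whether \<open>A\<close> belongs to a prime theory can be read off its shift at
  \<open>Imp Top A\<close>: (Fa) gives one direction and \<open>nabla_imp_mp\<close> the
  other.\<close>

lemma shift_reflects_subset:
  assumes "Fa \<in> R" and P: "prime P" and Q: "prime Q" and sub: "shift P \<subseteq> shift Q"
  shows "P \<subseteq> Q"
proof
  fix A assume A: "A \<in> P"
  then have L: "A \<in> L" using prime_subset[OF P] by blast
  have "{#A#} \<turnstile> {#\<^bold>\<nabla> (\<^bold>\<top> \<^bold>\<rightarrow> A)#}"
    using weaken[OF identity[OF L], of "{#\<^bold>\<top>#}"] by (intro rule_Fa[OF assms(1)]) simp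
  then have "\<^bold>\<top> \<^bold>\<rightarrow> A \<in> shift P"
    using prime_closed[OF P] A by (simp add: shift_def)
  then have "\<^bold>\<nabla> (\<^bold>\<top> \<^bold>\<rightarrow> A) \<in> Q"
    using sub by (auto simp: shift_def)
  then show "A \<in> Q"
    using prime_closed[OF Q nabla_imp_mp[of "\<^bold>\<top>" A]] L prime_top[OF Q] by simp
qed

lemma shift_surjective:
  assumes "Fu \<in> R" and P: "prime P"
  obtains Q where "prime Q" "shift Q = P"
proof -
  \<comment> \<open>The formulas \<open>Nabla F\<close> with \<open>F\<close> outside
    \<open>P\<close> need not be closed under disjunction; the formulas entailing one of them are,
    because \<open>P\<close> is prime and \<open>Nabla\<close> is monotone.\<close>
  let ?I = "{E. \<exists>F. F \<in> L \<and> F \<notin> P \<and> {#E#} \<turnstile> {#\<^bold>\<nabla> F#}}"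
  have in_I: "\<^bold>\<nabla> F \<in> ?I" if "F \<in> L" "F \<notin> P" for F
    using that identity[of "\<^bold>\<nabla> F"] by auto
  have "Nabla ` P \<subseteq> L"
    using prime_subset[OF P] by auto
  moreover have "?I \<subseteq> L"
    using wf by fastforce
  moreover have "?I \<noteq> {}"
    using in_I[of "\<^bold>\<bottom>"] prime_bot[OF P] by fastforce
  moreover have "A \<^bold>\<or> B \<in> ?I" if AB: "A \<in> ?I" "B \<in> ?I" for A B
  proof -
    from AB obtain F G where FG: "F \<in> L" "F \<notin> P" "{#A#} \<turnstile> {#\<^bold>\<nabla> F#}"
      "G \<in> L" "G \<notin> P" "{#B#} \<turnstile> {#\<^bold>\<nabla> G#}"
      by blast
    have "{#A#} \<turnstile> {#\<^bold>\<nabla> (F \<^bold>\<or> G)#}" "{#B#} \<turnstile> {#\<^bold>\<nabla> (F \<^bold>\<or> G)#}"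
      using cut1[OF FG(3) nabla] cut1[OF FG(6) nabla] FG
      by (auto simp: or_right1 or_right2 identity)
    then have "{#A \<^bold>\<or> B#} \<turnstile> {#\<^bold>\<nabla> (F \<^bold>\<or> G)#}"
      by (rule or_left)
    moreover have "F \<^bold>\<or> G \<notin> P"
      using prime_or[OF P] FG by blast
    moreover have "F \<^bold>\<or> G \<in> L"
      using FG by simp
    ultimately show ?thesis by blast
  qed
  moreover have "\<not> proves (Nabla ` P) {#E#}" if E: "E \<in> ?I" for E
  proof
    from E obtain F where F: "F \<in> L" "F \<notin> P" "{#E#} \<turnstile> {#\<^bold>\<nabla> F#}" by blast
    assume "proves (Nabla ` P) {#E#}"
    then obtain \<Gamma> where \<Gamma>: "set_mset \<Gamma> \<subseteq> Nabla ` P" "\<Gamma> \<turnstile> {#E#}"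
      by (auto simp: proves_def)
    then obtain G where G: "G \<subseteq> P" "finite G" "set_mset \<Gamma> = Nabla ` G"
      by (meson finite_set_mset finite_subset_image)
    \<comment> \<open>Once both sides stand under \<open>Nabla\<close>, (Fu) removes it and leaves a
      derivation of \<open>F\<close> from members of \<open>P\<close>.\<close>
    have "Nablas (mset_set G) \<turnstile> Nablas {#F#}"
      by (rule structural[of \<Gamma>]) (use cut1[OF \<Gamma>(2) F(3)] G prime_subset[OF P] in auto)
    then have "mset_set G \<turnstile> {#F#}"
      by (rule nabla_reflects[OF assms(1)])
    then show False
      using prime_closed[OF P] G F by auto
  qed
  ultimately obtain Q where Q: "prime Q" "Nabla ` P \<subseteq> Q" "Q \<inter> ?I = {}"
    by (rule prime_extension)
  have "shift Q \<subseteq> P"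
  proof
    fix A assume "A \<in> shift Q"
    then have "\<^bold>\<nabla> A \<in> Q" by (simp add: shift_def)
    moreover from this have "A \<in> L" using prime_subset[OF Q(1)] by auto
    ultimately show "A \<in> P" using in_I Q by blast
  qed
  moreover have "P \<subseteq> shift Q" using Q by (auto simp: shift_def)
  ultimately show thesis using that Q by blast
qed

section \<open>Alexandrov topology on the prime theories\<close>

text \<open>With all up-sets open, every point has a least open neighbourhood, so interiors and
  direct images become quantifiers over the inclusion order.\<close>

definition canon :: "'p fm set topology" where
  "canon = topology (\<lambda>U. U \<subseteq> Collect prime \<and> (\<forall>P \<in> U. \<forall>Q. prime Q \<longrightarrow> P \<subseteq> Q \<longrightarrow> Q \<in> U))"

lemma openin_canon:
  "openin canon U \<longleftrightarrow>
     U \<subseteq> Collect prime \<and> (\<forall>P \<in> U. \<forall>Q. prime Q \<longrightarrow> P \<subseteq> Q \<longrightarrow> Q \<in> U)"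
proof -
  have "istopology (\<lambda>U. U \<subseteq> Collect prime \<and> (\<forall>P \<in> U. \<forall>Q. prime Q \<longrightarrow> P \<subseteq> Q \<longrightarrow> Q \<in> U))"
    unfolding istopology_def by blast
  then show ?thesis
    unfolding canon_def by (simp add: topology_inverse')
qed

lemma topspace_canon [simp]: "topspace canon = Collect prime"
proof
  show "topspace canon \<subseteq> Collect prime"
    using openin_topspace[of canon] unfolding openin_canon by blast
  show "Collect prime \<subseteq> topspace canon"
    by (rule openin_subset) (simp add: openin_canon)
qed

lemma interior_of_canon:
  "canon interior_of U = {P. prime P \<and> (\<forall>Q. prime Q \<longrightarrow> P \<subseteq> Q \<longrightarrow> Q \<in> U)}"
proof (rule interior_of_unique)
  show "openin canon {P. prime P \<and> (\<forall>Q. prime Q \<longrightarrow> P \<subseteq> Q \<longrightarrow> Q \<in> U)}"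
    unfolding openin_canon by blast
qed (auto simp: openin_canon)

text \<open>The least open neighbourhood of \<open>P\<close> is its up-set, and the preimage of that
  up-set consists of the prime \<open>Q\<close> with \<open>P \<subseteq> shift Q\<close>.\<close>

lemma direct_image_canon:
  "direct_image canon shift U = {P. prime P \<and> (\<forall>Q. prime Q \<longrightarrow> P \<subseteq> shift Q \<longrightarrow> Q \<in> U)}"
  (is "_ = ?W")
proof
  show "direct_image canon shift U \<subseteq> ?W"
    unfolding direct_image_def preimage_def openin_canon using prime_shift by fastforce
  have "openin canon ?W"
    unfolding openin_canon by blast
  moreover have "preimage canon shift ?W \<subseteq> U"
    unfolding preimage_def by auto
  ultimately show "?W \<subseteq> direct_image canon shift U"
    using direct_image_adjoint by blast
qed

text \<open>Between Alexandrov spaces continuity is monotonicity, and \<open>shift\<close> is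
  monotone.\<close>

lemma continuous_map_shift: "continuous_map canon canon shift"
  unfolding continuous_map_def openin_canon using prime_shift by (fastforce simp: shift_def)

lemma dyn_top_system_canon:
  assumes "Fa \<in> C \<Longrightarrow> Fa \<in> R" "Fu \<in> C \<Longrightarrow> Fu \<in> R"
  shows "dyn_top_system C canon shift"
  unfolding dyn_top_system_def
proof (intro conjI impI continuous_map_shift)
  assume "Fa \<in> C"
  then have refl: "P \<subseteq> Q" if "prime P" "prime Q" "shift P \<subseteq> shift Q" for P Q
    using shift_reflects_subset assms that by blast
  let ?Y = "subtopology canon (shift ` Collect prime)"
  have "open_map canon ?Y shift"
    unfolding open_map_def
  proof (intro allI impI)
    fix U assume U: "openin canon U"
    \<comment> \<open>The up-set generated by the image of \<open>U\<close>. On the range of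
      \<open>shift\<close> it adds nothing, since \<open>refl\<close> moves an inclusion between
      shifts back to one starting in \<open>U\<close>.\<close>
    let ?W = "{Q. prime Q \<and> (\<exists>P \<in> U. shift P \<subseteq> Q)}"
    have "openin canon ?W"
      unfolding openin_canon by blast
    moreover have "shift ` U = ?W \<inter> shift ` Collect prime"
    proof
      show "shift ` U \<subseteq> ?W \<inter> shift ` Collect prime"
        using U prime_shift unfolding openin_canon by blast
      show "?W \<inter> shift ` Collect prime \<subseteq> shift ` U"
      proof
        fix Q assume "Q \<in> ?W \<inter> shift ` Collect prime"
        then obtain P Q' where "P \<in> U" "prime Q'" "Q = shift Q'" "shift P \<subseteq> shift Q'"
          by blast
        moreover from this have "prime P"
          using U unfolding openin_canon by blast
        ultimately have "Q' \<in> U"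
          using U refl[of P Q'] unfolding openin_canon by blast
        then show "Q \<in> shift ` U"
          using \<open>Q = shift Q'\<close> by blast
      qed
    qed
    ultimately show "openin ?Y (shift ` U)"
      unfolding openin_subtopology by blast
  qed
  moreover have "continuous_map canon ?Y shift"
    using continuous_map_shift by (simp add: continuous_map_in_subtopology)
  moreover have "shift ` topspace canon = topspace ?Y"
    using prime_shift by (auto simp: topspace_subtopology)
  moreover have "inj_on shift (topspace canon)"
    using refl by (fastforce intro!: inj_onI)
  ultimately have "homeomorphic_map canon ?Y shift"
    by (intro bijective_open_imp_homeomorphic_map)
  then show "embedding_map canon canon shift"
    by (simp add: embedding_map_def)
next
  assume "Fu \<in> C"
  then have "\<exists>Q. prime Q \<and> shift Q = P" if "prime P" for P
    using shift_surjective assms that by metis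
  then show "shift ` topspace canon = topspace canon"
    using prime_shift by force
qed

section \<open>Canonical valuation and truth\<close>

text \<open>Only the atoms are read off from membership. The other clauses copy the equations of a
  model, so it is a model on all formulas, including those outside \<open>L\<close>.\<close>

primrec canon_val :: "'p fm \<Rightarrow> 'p fm set set" where
  "canon_val (Atom p) = {P. prime P \<and> Atom p \<in> P}"
| "canon_val \<^bold>\<top> = topspace canon"
| "canon_val \<^bold>\<bottom> = {}"
| "canon_val (A \<^bold>\<and> B) = canon_val A \<inter> canon_val B"
| "canon_val (A \<^bold>\<or> B) = canon_val A \<union> canon_val B"
| "canon_val (A \<^bold>\<rightarrow> B) = direct_image canon shift
     (canon interior_of ((topspace canon - canon_val A) \<union> canon_val B))"
| "canon_val (\<^bold>\<nabla> A) = preimage canon shift (canon_val A)"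
| "canon_val (A \<^bold>\<supset> B) = canon interior_of ((topspace canon - canon_val A) \<union> canon_val B)"

lemma top_model_canon: "top_model canon shift canon_val"
proof -
  have "openin canon (canon_val A)" for A
  proof (induction A)
    case (Atom p)
    then show ?case by (auto simp: openin_canon)
  next
    case (Nabla A)
    then show ?case using openin_preimage continuous_map_shift by simp
  qed (simp_all add: openin_direct_image openin_Int openin_Un del: topspace_canon)
  then show ?thesis
    by (simp add: top_model_def)
qed

text \<open>Prime theories contain only formulas of \<open>L\<close>, whereas
  \<open>canon_val\<close> evaluates \<open>HImp\<close> even without (H); hence the restriction to
  \<open>L\<close>.\<close>

lemma truth: "A \<in> L \<Longrightarrow> canon_val A = {P. prime P \<and> A \<in> P}"
proof (induction A)
  case (And A B)
  then show ?case using prime_and_iff by auto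
next
  case (Or A B)
  then show ?case using prime_or_iff by auto
next
  case (Imp A B)
  have "canon_val (A \<^bold>\<rightarrow> B) =
      {P. prime P \<and> (\<forall>Q. prime Q \<longrightarrow> P \<subseteq> shift Q \<longrightarrow> A \<in> Q \<longrightarrow> B \<in> Q)}"
  proof -
    \<comment> \<open>The direct image and the interior quantify over two successive steps;
      monotonicity of \<open>shift\<close> collapses them into one.\<close>
    have "P \<subseteq> shift Q'" if "P \<subseteq> shift Q" "Q \<subseteq> Q'" for P Q Q' :: "'p fm set"
      using that by (auto simp: shift_def)
    then show ?thesis
      using Imp by (simp add: direct_image_canon interior_of_canon) blast
  qed
  then show ?case using Imp prime_imp_iff by auto
next
  case (Nabla A)
  then show ?case using prime_shift by (auto simp: preimage_def shift_def)
next
  case (HImp A B)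
  then have L: "H \<in> R" "A \<in> L" "B \<in> L" by (auto simp: language_HImp)
  have "canon_val (A \<^bold>\<supset> B) = {P. prime P \<and> (\<forall>Q. prime Q \<longrightarrow> P \<subseteq> Q \<longrightarrow> A \<in> Q \<longrightarrow> B \<in> Q)}"
    using HImp.IH L by (simp add: interior_of_canon)
  then show ?case using prime_himp_iff L by auto
qed (auto simp: prime_top prime_bot)

section \<open>Completeness from the canonical model\<close>

lemma validates_canon_iff:
  assumes "(\<Gamma> \<Rrightarrow> \<Delta>) \<in> sequents R"
  shows "validates canon canon_val (\<Gamma> \<Rrightarrow> \<Delta>) \<longleftrightarrow>
    (\<forall>P. prime P \<longrightarrow> set_mset \<Gamma> \<subseteq> P \<longrightarrow> (\<exists>\<delta> \<in># \<Delta>. \<delta> \<in> P))"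
proof -
  have "canon_val A = {P. prime P \<and> A \<in> P}" if "A \<in># \<Gamma> \<or> A \<in># \<Delta>" for A
    using truth that assms by auto
  then show ?thesis
    unfolding validates_iff by (auto simp: subset_iff)
qed

lemma at_most_one_cases:
  assumes "size \<Delta> \<le> 1"
  obtains "\<Delta> = {#}" | A where "\<Delta> = {#A#}"
  using assms by (cases \<Delta>) auto

text \<open>Both directions serve completeness: the hypotheses in \<open>\<S>\<close> are derivable
  and hence valid, and a valid conclusion is derivable.\<close>

lemma validates_canon_iff_derives:
  assumes S: "S \<in> sequents R"
  shows "validates canon canon_val S \<longleftrightarrow> derives R \<S> S"
proof -
  obtain \<Gamma> \<Delta> where S_eq: "S = (\<Gamma> \<Rrightarrow> \<Delta>)" by (cases S)
  then have wfS: "size \<Delta> \<le> 1" "set_mset \<Gamma> \<subseteq> L" "set_mset \<Delta> \<subseteq> L"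
    using S by auto
  \<comment> \<open>A single formula standing for the succedent, with \<bottom> for the empty one,
    so that prime extension avoiding one formula applies.\<close>
  define E where "E = (if \<Delta> = {#} then \<^bold>\<bottom> else (SOME A. \<Delta> = {#A#}))"
  have E: "E \<in> L" "\<Gamma> \<turnstile> {#E#} \<longleftrightarrow> \<Gamma> \<turnstile> \<Delta>"
    and E_mem: "\<And>P. prime P \<Longrightarrow> (\<exists>\<delta> \<in># \<Delta>. \<delta> \<in> P) \<longleftrightarrow> E \<in> P"
    using wfS by (cases rule: at_most_one_cases[OF wfS(1)];
        auto simp: E_def prime_bot intro: weak_right cut1[OF _ bot_left])+
  have "(\<forall>P. prime P \<longrightarrow> set_mset \<Gamma> \<subseteq> P \<longrightarrow> E \<in> P) \<longleftrightarrow> \<Gamma> \<turnstile> {#E#}"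
  proof
    assume all: "\<forall>P. prime P \<longrightarrow> set_mset \<Gamma> \<subseteq> P \<longrightarrow> E \<in> P"
    then have "proves (set_mset \<Gamma>) {#E#}"
      using prime_extension_avoiding[OF wfS(2) E(1)] by blast
    then show "\<Gamma> \<turnstile> {#E#}"
      using structural wfS unfolding proves_def by blast
  qed (use prime_closed in blast)
  then show ?thesis
    using validates_canon_iff[of \<Gamma> \<Delta>] S E(2) E_mem unfolding S_eq by auto
qed

theorem completeness:
  assumes ent: "entails TYPE('p fm set) C \<S> S"
    and C: "Fa \<in> C \<Longrightarrow> Fa \<in> R" "Fu \<in> C \<Longrightarrow> Fu \<in> R"
    and wfS: "\<S> \<subseteq> sequents R" "S \<in> sequents R"
  shows "derives R \<S> S"
proof -
  have "validates canon canon_val S'" if "S' \<in> \<S>" for S'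
    using validates_canon_iff_derives that wfS derives.hyp by blast
  then have "validates canon canon_val S"
    using ent dyn_top_system_canon[OF C] top_model_canon unfolding entails_def by blast
  then show ?thesis
    using validates_canon_iff_derives wfS by blast
qed

end

section \<open>Derivability and topological consequence\<close>

theorem theorem6p14:
  fixes C :: "axiom_name set" and \<S> :: "'p sequent set" and S :: "'p sequent"
  assumes "C \<subseteq> {Fa, Fu}"
  shows "(\<S> \<subseteq> sequents (C \<union> {N, D}) \<and> S \<in> sequents (C \<union> {N, D}) \<longrightarrow>
            (derives (C \<union> {N, D}) \<S> S \<longleftrightarrow> entails TYPE('p fm set) C \<S> S) \<and>
            (derives (C \<union> {N, D}) \<S> S \<longrightarrow> entails TYPE('x) C \<S> S)) \<and>
         (\<S> \<subseteq> sequents (C \<union> {N, H}) \<and> S \<in> sequents (C \<union> {N, H}) \<longrightarrow>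
            (derives (C \<union> {N, H}) \<S> S \<longleftrightarrow> entails TYPE('p fm set) C \<S> S) \<and>
            (derives (C \<union> {N, H}) \<S> S \<longrightarrow> entails TYPE('x) C \<S> S))"
proof -
  have complete: "derives (C \<union> {N, E}) \<S> S"
    if E: "E = D \<or> E = H" and "entails TYPE('p fm set) C \<S> S"
      "\<S> \<subseteq> sequents (C \<union> {N, E})" "S \<in> sequents (C \<union> {N, E})" for E
  proof -
    interpret modal_calculus "C \<union> {N, E}" \<S>
      by unfold_locales (use E in auto)
    show ?thesis
      using completeness[of C S] that by blast
  qed
  \<comment> \<open>Soundness is instantiated twice: at the points of the canonical model, to close
    the equivalence, and at an arbitrary type of points.\<close>
  have sound: "entails TYPE('p fm set) C \<S> S"
    if "E = D \<or> E = H" "derives (C \<union> {N, E}) \<S> S" for E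
    by (rule soundness[OF that(2)]) (use that(1) in auto)
  have sound': "entails TYPE('x) C \<S> S"
    if "E = D \<or> E = H" "derives (C \<union> {N, E}) \<S> S" for E
    by (rule soundness[OF that(2)]) (use that(1) in auto)
  show ?thesis
    using complete sound sound' by blast
qed

end
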